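(* Let $\mathcal{X},\mathcal{Y}$ be finite alphabets, let $P_{XY}$ be a probability distribution on $\mathcal{X}\times\mathcal{Y}$ with $\mathcal{X}$-marginal $P_X$, and let $E_0>0$. Define the variable-rate FR--FA trade-off function $$E_{\mathrm{FR}}^{\mathrm{v}}[E_0]=\min_{\{Q_{XY}:\ D(Q_X\|P_X)\le E_0\}}\left\{D(Q_{XY}\|P_{XY})+\left[\mathbf{E}_Q\ln\frac{1}{P_X(X)}-E_0-H_Q(X|Y)\right]_+\right\},$$ where the minimum is over probability distributions $Q_{XY}$ on $\mathcal{X}\times\mathcal{Y}$ whose $\mathcal{X}$-marginal $Q_X$ satisfies the indicated constraint. Then $$E_{\mathrm{FR}}^{\mathrm{v}}[E_0]=\max_{0\le\lambda\le 1}\ \sup_{\rho\ge 0}\ \max_{W}\left\{-\ln\left(\sum_{y\in\mathcal{Y}}\left[\sum_{x\in\mathcal{X}}\left[P_{XY}(x,y)\,P_X(x)^{\rho+\lambda}\,W(x)^{-\rho}\right]^{1/(1+\lambda)}\right]^{1+\lambda}\right)-(\rho+\lambda)E_0\right\},$$ where the maximum over $W$ is over the simplex of probability distributions on $\mathcal{X}$, i.e., $W(x)\ge 0$ for all $x\in\mathcal{X}$ and $\sum_{x\in\mathcal{X}}W(x)=1$.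
   Context: All logarithms are natural and $[t]_+=\max\{0,t\}$. For a distribution $Q=Q_{XY}$ on $\mathcal{X}\times\mathcal{Y}$ with marginals $Q_X$, $Q_Y$: $D(\cdot\|\cdot)$ is the Kullback--Leibler divergence (equal to $+\infty$ when absolute continuity fails), $H_Q(X|Y)$ is the conditional Shannon entropy of $X$ given $Y$ under $Q_{XY}$, and $\mathbf{E}_Q\ln\frac{1}{P_X(X)}=\sum_{x}Q_X(x)\ln\frac{1}{P_X(x)}$. Conventions: $0\ln 0=0$; $W(x)^{-\rho}=1$ when $\rho=0$ and $W(x)^{-\rho}=+\infty$ when $W(x)=0$ and $\rho>0$; a term of the sum over $x$ with $P_{XY}(x,y)=0$ is taken to be $0$; and $-\ln(+\infty)=-\infty$. *)

theory Defs
  imports "HOL-Probability.Probability"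
begin

section \<open>Information measures on finite alphabets (in nats)\<close>

definition kl :: "'a::finite pmf \<Rightarrow> 'a pmf \<Rightarrow> ereal" where
  "kl Q P =
     (if absolutely_continuous (measure_pmf P) (measure_pmf Q)
      then ereal (KL_divergence (exp 1) (measure_pmf P) (measure_pmf Q))
      else \<infinity>)"

text \<open>\<open>cond_entropy Q\<close> is $H_Q(X|Y)$, where $X$ and $Y$ are the first and the second component.\<close>

definition cond_entropy :: "('x::finite \<times> 'y::finite) pmf \<Rightarrow> real" where
  "cond_entropy Q =
     prob_space.conditional_entropy (measure_pmf Q) (exp 1)
       (count_space UNIV) (count_space UNIV) fst snd"

lemma absolutely_continuous_pmf_iff:
  "absolutely_continuous (measure_pmf P) (measure_pmf Q) \<longleftrightarrow> set_pmf Q \<subseteq> set_pmf P"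
proof
  assume ac: "absolutely_continuous (measure_pmf P) (measure_pmf Q)"
  show "set_pmf Q \<subseteq> set_pmf P"
  proof
    fix x assume x: "x \<in> set_pmf Q"
    show "x \<in> set_pmf P"
    proof (rule ccontr)
      assume "x \<notin> set_pmf P"
      then have "{x} \<in> null_sets (measure_pmf P)"
        by (auto simp: null_sets_def emeasure_pmf_single pmf_eq_0_set_pmf)
      then have "{x} \<in> null_sets (measure_pmf Q)"
        using ac by (auto simp: absolutely_continuous_def)
      then show False
        using x by (auto simp: null_sets_def emeasure_pmf_single set_pmf_iff)
    qed
  qed
next
  assume "set_pmf Q \<subseteq> set_pmf P"
  then show "absolutely_continuous (measure_pmf P) (measure_pmf Q)"
    unfolding absolutely_continuous_def null_sets_def
    by (auto simp: measure_pmf.emeasure_eq_measure measure_pmf_zero_iff)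
qed

lemma kl_altdef:
  fixes P Q :: "'a::finite pmf"
  shows "kl Q P =
     (if set_pmf Q \<subseteq> set_pmf P then ereal (\<Sum>x\<in>UNIV. pmf Q x * ln (pmf Q x / pmf P x)) else \<infinity>)"
proof (cases "set_pmf Q \<subseteq> set_pmf P")
  case True
  interpret sigma_finite_measure "count_space (UNIV :: 'a set)"
    by (rule sigma_finite_measure_count_space_finite) simp
  have "KL_divergence (exp 1) (measure_pmf P) (measure_pmf Q) =
        KL_divergence (exp 1) (density (count_space UNIV) (\<lambda>x. ennreal (pmf P x)))
                              (density (count_space UNIV) (\<lambda>x. ennreal (pmf Q x)))"
    by (simp add: measure_pmf_eq_density)
  also have "\<dots> = (\<integral>x. pmf Q x * log (exp 1) (pmf Q x / pmf P x) \<partial>count_space UNIV)"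
    using True by (intro KL_density_density) (auto simp: AE_count_space pmf_eq_0_set_pmf)
  finally show ?thesis
    using True
    by (simp add: kl_def absolutely_continuous_pmf_iff lebesgue_integral_count_space_finite log_def)
qed (simp add: kl_def absolutely_continuous_pmf_iff)

lemma cond_entropy_altdef:
  fixes Q :: "('x::finite \<times> 'y::finite) pmf"
  shows "cond_entropy Q =
     - (\<Sum>(x, y)\<in>UNIV. pmf Q (x, y) * ln (pmf Q (x, y) / pmf (map_pmf snd Q) y))"
proof -
  interpret information_space "measure_pmf Q" "exp 1"
    by unfold_locales simp
  have pair: "count_space UNIV \<Otimes>\<^sub>M count_space UNIV = (count_space UNIV :: ('x \<times> 'y) measure)"
    by (simp add: pair_measure_count_space)
  have "cond_entropy Q = - (\<integral>(x, y). pmf Q (x, y) * log (exp 1) (pmf Q (x, y) / pmf (map_pmf snd Q) y)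
          \<partial>(count_space UNIV \<Otimes>\<^sub>M count_space UNIV))"
    unfolding cond_entropy_def
  proof (rule conditional_entropy_generic_eq)
    show "distributed (measure_pmf Q) (count_space UNIV) snd (\<lambda>x. ennreal (pmf (map_pmf snd Q) x))"
      unfolding distributed_def
      using measure_pmf_eq_density[of "map_pmf snd Q"] by (simp add: map_pmf_rep_eq)
    show "distributed (measure_pmf Q) (count_space UNIV \<Otimes>\<^sub>M count_space UNIV)
            (\<lambda>x. (fst x, snd x)) (\<lambda>x. ennreal (pmf Q x))"
      unfolding distributed_def pair
      using measure_pmf_eq_density[of Q] map_pmf_rep_eq[of "\<lambda>x. x" Q] by simp
  qed (auto intro: sigma_finite_measure_count_space_finite)
  then show ?thesis
    by (simp add: pair lebesgue_integral_count_space_finite log_def case_prod_unfold)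
qed

section \<open>Logarithm and real powers on the extended half-line\<close>

definition eln :: "ennreal \<Rightarrow> ereal" where
  "eln z = (if z = 0 then -\<infinity> else if z = \<infinity> then \<infinity> else ereal (ln (enn2real z)))"

text \<open>In contrast to \<open>powr\<close> on the reals, a zero base with exponent \<open>0\<close> gives \<open>1\<close>, and with a
  negative exponent it gives \<open>\<infinity>\<close>.\<close>

definition epowr :: "ennreal \<Rightarrow> real \<Rightarrow> ennreal" where
  "epowr z a =
     (if a = 0 then 1
      else if z = 0 then (if a < 0 then \<infinity> else 0)
      else if z = \<infinity> then (if a < 0 then 0 else \<infinity>)
      else ennreal (enn2real z powr a))"

section \<open>The trade-off function and its Lagrangian form\<close>

text \<open>\<open>self_info Q P\<close> is $\mathbf{E}_Q \ln (1 / P(X))$, with $1/0 = \infty$ and $0 \cdot \infty = 0$.\<close>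

definition self_info :: "'x::finite pmf \<Rightarrow> 'x pmf \<Rightarrow> ereal" where
  "self_info Q P = (\<Sum>x\<in>UNIV. ereal (pmf Q x) * eln (1 / ennreal (pmf P x)))"

definition FR_feasible ::
    "('x::finite \<times> 'y::finite) pmf \<Rightarrow> real \<Rightarrow> ('x \<times> 'y) pmf set" where
  "FR_feasible P E0 = {Q. kl (map_pmf fst Q) (map_pmf fst P) \<le> ereal E0}"

definition FR_objective ::
    "('x::finite \<times> 'y::finite) pmf \<Rightarrow> real \<Rightarrow> ('x \<times> 'y) pmf \<Rightarrow> ereal" where
  "FR_objective P E0 Q =
     kl Q P + max 0 (self_info (map_pmf fst Q) (map_pmf fst P) - ereal E0 - ereal (cond_entropy Q))"

definition E_FR :: "('x::finite \<times> 'y::finite) pmf \<Rightarrow> real \<Rightarrow> ereal" where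
  "E_FR P E0 = (INF Q\<in>FR_feasible P E0. FR_objective P E0 Q)"

text \<open>Since $0 \cdot \infty = 0$ in \<^typ>\<open>ennreal\<close>, a summand with \<open>pmf P (x, y) = 0\<close> vanishes, even if
  \<open>W x = 0\<close>.\<close>

definition FR_dual ::
    "('x::finite \<times> 'y::finite) pmf \<Rightarrow> real \<Rightarrow> real \<Rightarrow> real \<Rightarrow> 'x pmf \<Rightarrow> ereal" where
  "FR_dual P E0 l \<rho> W =
     - eln (\<Sum>y\<in>UNIV.
         epowr
           (\<Sum>x\<in>UNIV.
             epowr
               (ennreal (pmf P (x, y)) * epowr (ennreal (pmf (map_pmf fst P) x)) (\<rho> + l)
                  * epowr (ennreal (pmf W x)) (- \<rho>))
               (1 / (1 + l)))
           (1 + l))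
     - ereal ((\<rho> + l) * E0)"

end

(* The positive part is the maximum of its argument times l over l in [0, 1], and the constraint is
   paid for by a multiplier rho; as everything is convex and Q = P is a Slater point, separation in
   R^3 yields multipliers for which the minimum of the Lagrangian is the primal value. For the fixed
   multipliers, D(Q_X || P_X) is the maximum over W of the linear function E_Q ln (W / P_X). With W
   in place, the Lagrangian minus its minimum is a nonnegative combination of two divergences, which evaluates that
   minimum to the dual function. If Q minimises the Lagrangian with the divergence, then W = Q_X
   attains the maximum over W and loses nothing. *)

theory Submission
  imports Defs "HOL-Real_Asymp.Real_Asymp"
begin

section \<open>Probability mass functions on finite types\<close>

text \<open>The obstacle is an order of quantifiers: W is maximized outside the minimum over Q,
  while the variational formula for the divergence puts it inside. No minimax theorem is invoked; a
  single W is exhibited. It is admissible only if it charges the whole support of P_X, because for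
  \<rho> > 0 a W that misses a point of it makes the dual function minus infinity. The infinite
  slope of the divergence at the boundary of the simplex supplies this. The shape of the dual
  function comes from splitting Q into Q_Y and Q_{X|Y}: the logarithm of Q_{X|Y} is weighted once by
  D(Q || P) and \<lambda> times by the entropy term, whence the exponents 1/(1+\<lambda>) and
  1+\<lambda>. All Q are kept inside the support of P: the set of such Q is compact, and on it all
  quantities are real and continuous.\<close>

lemma exists_pmf_finite:
  fixes g :: "'a::finite \<Rightarrow> real"
  assumes "\<And>x. 0 \<le> g x" "(\<Sum>x\<in>UNIV. g x) = 1"
  shows "\<exists>R. \<forall>x. pmf R x = g x"
proof -
  have "(\<integral>\<^sup>+ x. ennreal (g x) \<partial>count_space UNIV) = 1"
    using assms by (simp add: nn_integral_count_space_finite sum_ennreal)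
  then show ?thesis
    using assms(1) by (intro exI[of _ "embed_pmf g"]) (simp add: pmf_embed_pmf)
qed

lemma sum_pmf_UNIV [simp]: "(\<Sum>x\<in>UNIV. pmf (Q :: 'a::finite pmf) x) = 1"
  by (rule sum_pmf_eq_1) auto

lemma sum_map_pmf:
  fixes Q :: "'a::finite pmf" and f :: "'a \<Rightarrow> 'b::finite" and g :: "'b \<Rightarrow> real"
  shows "(\<Sum>x\<in>UNIV. pmf (map_pmf f Q) x * g x) = (\<Sum>z\<in>UNIV. pmf Q z * g (f z))"
proof -
  have "(\<Sum>x\<in>UNIV. pmf (map_pmf f Q) x * g x) = measure_pmf.expectation (map_pmf f Q) g"
    by (subst integral_measure_pmf_real[of UNIV]) (auto simp: mult.commute)
  also have "\<dots> = measure_pmf.expectation Q (\<lambda>z. g (f z))"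
    by (rule integral_map_pmf)
  also have "\<dots> = (\<Sum>z\<in>UNIV. pmf Q z * g (f z))"
    by (subst integral_measure_pmf_real[of UNIV]) (auto simp: mult.commute)
  finally show ?thesis .
qed

lemma pmf_map_finite:
  fixes Q :: "'a::finite pmf" and f :: "'a \<Rightarrow> 'b::finite"
  shows "pmf (map_pmf f Q) x = (\<Sum>z | f z = x. pmf Q z)"
  by (simp add: pmf_map measure_measure_pmf_finite vimage_def)

lemma pmf_map_ge:
  fixes Q :: "'a::finite pmf" and f :: "'a \<Rightarrow> 'b::finite"
  shows "pmf Q z \<le> pmf (map_pmf f Q) (f z)"
  unfolding pmf_map_finite by (rule member_le_sum) auto

lemma pmf_map_snd:
  fixes Q :: "('x::finite \<times> 'y::finite) pmf"
  shows "pmf (map_pmf snd Q) y = (\<Sum>x\<in>UNIV. pmf Q (x, y))"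
proof -
  have "{z :: 'x \<times> 'y. snd z = y} = (\<lambda>x. (x, y)) ` UNIV" by auto
  then show ?thesis
    by (simp add: pmf_map_finite sum.reindex inj_on_def)
qed

text \<open>A Bernoulli draw between the two laws plays the part of the convex combination, so that
  marginals of mixtures follow from the monad laws.\<close>

definition mix_pmf :: "real \<Rightarrow> 'a pmf \<Rightarrow> 'a pmf \<Rightarrow> 'a pmf" where
  "mix_pmf t Q R = bind_pmf (bernoulli_pmf t) (\<lambda>b. if b then R else Q)"

lemma pmf_mix:
  assumes "0 \<le> t" "t \<le> 1"
  shows "pmf (mix_pmf t Q R) x = (1 - t) * pmf Q x + t * pmf R x"
  using assms by (simp add: mix_pmf_def pmf_bind)

lemma map_mix_pmf: "map_pmf f (mix_pmf t Q R) = mix_pmf t (map_pmf f Q) (map_pmf f R)"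
  unfolding mix_pmf_def map_bind_pmf by (intro bind_pmf_cong) auto

lemma set_mix_pmf_subset: "set_pmf (mix_pmf t Q R) \<subseteq> set_pmf Q \<union> set_pmf R"
  by (auto simp: mix_pmf_def split: if_splits)

text \<open>On a finite type this is convergence in the simplex; sequences are all that the
  compactness argument uses.\<close>

definition pmf_tendsto :: "(nat \<Rightarrow> 'a pmf) \<Rightarrow> 'a pmf \<Rightarrow> bool" where
  "pmf_tendsto X Q \<longleftrightarrow> (\<forall>x. (\<lambda>n. pmf (X n) x) \<longlonglongrightarrow> pmf Q x)"

lemma pmf_tendsto_map:
  fixes X :: "nat \<Rightarrow> 'a::finite pmf" and f :: "'a \<Rightarrow> 'b::finite"
  shows "pmf_tendsto X Q \<Longrightarrow> pmf_tendsto (\<lambda>n. map_pmf f (X n)) (map_pmf f Q)"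
  unfolding pmf_tendsto_def pmf_map_finite by (intro allI tendsto_sum) auto

lemma pmf_tendsto_set_subset:
  assumes "pmf_tendsto X Q" "\<And>n. set_pmf (X n) \<subseteq> S"
  shows "set_pmf Q \<subseteq> S"
proof
  fix x assume "x \<in> set_pmf Q"
  show "x \<in> S"
  proof (rule ccontr)
    assume "x \<notin> S"
    then have "pmf (X n) x = 0" for n
      using assms(2)[of n] by (auto simp: pmf_eq_0_set_pmf)
    then have "pmf Q x = 0"
      using assms(1) unfolding pmf_tendsto_def by (metis (mono_tags, lifting) LIMSEQ_const_iff tendsto_cong always_eventually)
    then show False
      using \<open>x \<in> set_pmf Q\<close> by (simp add: pmf_eq_0_set_pmf)
  qed
qed

text \<open>The probability vectors lie in the unit cube of \<open>real ^ 'a\<close>, which is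
  compact. The total mass is a finite sum and passes to the limit.\<close>

lemma pmf_seq_compact:
  fixes X :: "nat \<Rightarrow> 'a::finite pmf"
  obtains r Q where "strict_mono r" "pmf_tendsto (X \<circ> r) Q"
proof -
  define v where "v n = (\<chi> i. pmf (X n) i)" for n
  have "v n \<in> cbox 0 1" for n
    by (auto simp: v_def mem_box_cart pmf_le_1)
  then obtain l r where l: "l \<in> cbox 0 1" "strict_mono (r :: nat \<Rightarrow> nat)" "(v \<circ> r) \<longlonglongrightarrow> l"
    using compact_cbox[of 0 "1 :: real ^ 'a"] unfolding compact_def by metis
  have lim: "(\<lambda>n. pmf (X (r n)) i) \<longlonglongrightarrow> l $ i" for i
    using tendsto_vec_nth[OF l(3), of i] by (simp add: v_def o_def)
  have "(\<lambda>n. \<Sum>i\<in>UNIV. pmf (X (r n)) i) \<longlonglongrightarrow> (\<Sum>i\<in>UNIV. l $ i)"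
    by (intro tendsto_sum lim)
  then have "(\<Sum>i\<in>UNIV. l $ i) = 1"
    by (simp add: LIMSEQ_const_iff)
  moreover have "0 \<le> l $ i" for i
    using l(1) by (auto simp: mem_box_cart)
  ultimately obtain Q where "\<forall>i. pmf Q i = l $ i"
    using exists_pmf_finite[of "\<lambda>i. l $ i"] by auto
  then have "pmf_tendsto (X \<circ> r) Q"
    using lim by (simp add: pmf_tendsto_def)
  with l(2) show thesis by (rule that)
qed

lemma pmf_attains_min:
  fixes F :: "'a::finite pmf \<Rightarrow> real"
  assumes "A \<noteq> {}"
    and closed: "\<And>X Q. (\<And>n. X n \<in> A) \<Longrightarrow> pmf_tendsto X Q \<Longrightarrow> Q \<in> A"
    and cont: "\<And>X Q. (\<And>n. X n \<in> A) \<Longrightarrow> pmf_tendsto X Q \<Longrightarrow> (\<lambda>n. F (X n)) \<longlonglongrightarrow> F Q"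
  obtains Q where "Q \<in> A" "\<And>R. R \<in> A \<Longrightarrow> F Q \<le> F R"
proof -
  \<comment> \<open>In \<open>ereal\<close> the infimum exists before anything is known about lower
    bounds; the limit along the minimizing sequence then identifies it with the real number
    \<open>F Q\<close>.\<close>
  have "(\<lambda>Q. ereal (F Q)) ` A \<noteq> {}" using assms(1) by auto
  from Inf_as_limit[OF this] obtain u where
    u: "\<And>n. u n \<in> (\<lambda>Q. ereal (F Q)) ` A" "u \<longlonglongrightarrow> Inf ((\<lambda>Q. ereal (F Q)) ` A)"
    by auto
  from u(1) have "\<forall>n. \<exists>Q\<in>A. u n = ereal (F Q)" by auto
  then obtain X where X: "\<And>n. X n \<in> A" "\<And>n. u n = ereal (F (X n))" by metis
  obtain r Q where r: "strict_mono r" "pmf_tendsto (X \<circ> r) Q"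
    using pmf_seq_compact by blast
  have "(\<lambda>n. ereal (F ((X \<circ> r) n))) \<longlonglongrightarrow> ereal (F Q)"
    using cont[OF _ r(2)] X(1) by simp
  moreover have "(\<lambda>n. ereal (F ((X \<circ> r) n))) \<longlonglongrightarrow> Inf ((\<lambda>Q. ereal (F Q)) ` A)"
    using LIMSEQ_subseq_LIMSEQ[OF u(2) r(1)] by (simp add: X(2) o_def)
  ultimately have "ereal (F Q) = Inf ((\<lambda>Q. ereal (F Q)) ` A)"
    by (rule LIMSEQ_unique)
  then have "F Q \<le> F R" if "R \<in> A" for R
    using that by (metis INF_lower ereal_less_eq(3))
  moreover have "Q \<in> A" using closed[OF _ r(2)] X(1) by simp
  ultimately show thesis using that by blast
qed

section \<open>Relative entropy and its convexity\<close>

lemma tendsto_mult_ln: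
  fixes a :: "nat \<Rightarrow> real"
  assumes lim: "a \<longlonglongrightarrow> l" and nonneg: "\<And>n. 0 \<le> a n"
  shows "(\<lambda>n. a n * ln (a n)) \<longlonglongrightarrow> l * ln l"
proof (cases "l = 0")
  case False
  then show ?thesis by (intro tendsto_mult tendsto_ln lim)
next
  case True
  have "((\<lambda>t::real. t * ln t) \<longlongrightarrow> 0) (at_right 0)"
    by real_asymp
  then have "((\<lambda>t::real. t * ln t) \<longlongrightarrow> 0) (at 0 within {0..})"
    by (simp add: at_within_Ici_at_right)
  then have "continuous (at 0 within {0..}) (\<lambda>t::real. t * ln t)"
    by (simp add: continuous_within)
  from continuous_within_tendsto_compose'[OF this _ lim[unfolded True]] nonneg True
  show ?thesis by simp
qed

text \<open>This is ln u \<le> u - 1 at u = b / a. Summed over the alphabet, it bounds a divergence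
  below by the difference of the total masses, which also serves when the second argument has mass
  below 1.\<close>

lemma mult_ln_div_ge:
  assumes "0 \<le> (a::real)" "0 \<le> b" "b = 0 \<Longrightarrow> a = 0"
  shows "a - b \<le> a * ln (a / b)"
proof (cases "a = 0")
  case False
  then have pos: "a > 0" "b > 0" using assms by (auto simp: less_le)
  then have "ln (b / a) \<le> b / a - 1" by (intro ln_le_minus_one) auto
  then have "a * (- ln (a / b)) \<le> a * (b / a - 1)"
    using pos by (intro mult_left_mono) (auto simp: ln_div)
  then show ?thesis using pos by (simp add: algebra_simps)
qed (use assms in auto)

lemma log_sum_ineq:
  assumes "0 \<le> (a::real)" "0 \<le> b" "0 \<le> c" "0 \<le> d" "b = 0 \<Longrightarrow> a = 0" "d = 0 \<Longrightarrow> c = 0"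
  shows "(a + c) * ln ((a + c) / (b + d)) \<le> a * ln (a / b) + c * ln (c / d)"
proof (cases "a + c = 0")
  case True
  then have "a = 0" "c = 0" using assms by linarith+
  then show ?thesis by simp
next
  case False
  then have pos: "a + c > 0" "b + d > 0" using assms by (auto simp: add_nonneg_eq_0_iff less_le)
  \<comment> \<open>With the ratio of the totals as slope, the linear corrections u - v * s of the
    two summands cancel.\<close>
  define s where "s = (a + c) / (b + d)"
  have s: "s > 0" using pos by (simp add: s_def)
  have *: "u * ln s + (u - v * s) \<le> u * ln (u / v)"
    if "0 \<le> u" "0 \<le> v" "v = 0 \<Longrightarrow> u = 0" for u v
  proof (cases "u = 0")
    case False
    then have "u > 0" "v > 0" using that by (auto simp: less_le)
    then show ?thesis
      using mult_ln_div_ge[of u "v * s"] s by (simp add: ln_div ln_mult algebra_simps)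
  qed (use that s in auto)
  have "(a - b * s) + (c - d * s) = 0" using pos by (simp add: s_def field_simps)
  moreover have "a * ln s + (a - b * s) \<le> a * ln (a / b)" "c * ln s + (c - d * s) \<le> c * ln (c / d)"
    by (intro * assms; assumption)+
  ultimately have "a * ln s + c * ln s \<le> a * ln (a / b) + c * ln (c / d)"
    by linarith
  then show ?thesis by (simp add: s_def distrib_right)
qed

text \<open>Joint convexity is the log-sum inequality for the pairs scaled by 1 - t and t. Both
  arguments move in the conditional entropy; in a divergence from a fixed law the second one
  stays.\<close>

lemma convex_mult_ln_div:
  assumes "0 \<le> (a::real)" "0 \<le> b" "0 \<le> c" "0 \<le> d" "b = 0 \<Longrightarrow> a = 0" "d = 0 \<Longrightarrow> c = 0"
    and "0 \<le> t" "t \<le> 1"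
  shows "((1 - t) * a + t * c) * ln (((1 - t) * a + t * c) / ((1 - t) * b + t * d))
    \<le> (1 - t) * (a * ln (a / b)) + t * (c * ln (c / d))"
  using log_sum_ineq[of "(1 - t) * a" "(1 - t) * b" "t * c" "t * d"] assms
  by (cases "t = 0"; cases "t = 1") auto

text \<open>Agrees with \<open>kl\<close> only if the support of \<open>Q\<close> lies in that of
  \<open>P\<close>; otherwise the sum stays finite where the divergence is infinite. Hence the
  support hypotheses throughout.\<close>

definition rel_ent :: "'a::finite pmf \<Rightarrow> 'a pmf \<Rightarrow> real" where
  "rel_ent Q P = (\<Sum>x\<in>UNIV. pmf Q x * ln (pmf Q x / pmf P x))"

lemma rel_ent_self [simp]: "rel_ent P P = 0"
  unfolding rel_ent_def by (rule sum.neutral) (metis div_self ln_one mult_zero_left mult_zero_right)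

lemma rel_ent_nonneg:
  assumes "set_pmf Q \<subseteq> set_pmf P"
  shows "0 \<le> rel_ent Q P"
proof -
  have "(\<Sum>x\<in>UNIV. pmf Q x - pmf P x) \<le> rel_ent Q P"
    unfolding rel_ent_def using assms
    by (intro sum_mono mult_ln_div_ge) (auto simp: pmf_eq_0_set_pmf)
  then show ?thesis by (simp add: sum_subtractf)
qed

lemma rel_ent_mix_le:
  assumes "set_pmf Q \<subseteq> set_pmf P" "set_pmf R \<subseteq> set_pmf P" "0 \<le> t" "t \<le> 1"
  shows "rel_ent (mix_pmf t Q R) P \<le> (1 - t) * rel_ent Q P + t * rel_ent R P"
proof -
  have "rel_ent (mix_pmf t Q R) P
      \<le> (\<Sum>x\<in>UNIV. (1 - t) * (pmf Q x * ln (pmf Q x / pmf P x)) + t * (pmf R x * ln (pmf R x / pmf P x)))"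
    unfolding rel_ent_def
  proof (rule sum_mono)
    fix x
    have "pmf P x = 0 \<Longrightarrow> pmf Q x = 0" "pmf P x = 0 \<Longrightarrow> pmf R x = 0"
      using assms(1,2) by (metis pmf_eq_0_set_pmf subsetD)+
    then show "pmf (mix_pmf t Q R) x * ln (pmf (mix_pmf t Q R) x / pmf P x)
      \<le> (1 - t) * (pmf Q x * ln (pmf Q x / pmf P x)) + t * (pmf R x * ln (pmf R x / pmf P x))"
      using convex_mult_ln_div[of "pmf Q x" "pmf P x" "pmf R x" "pmf P x" t] assms
      by (auto simp: pmf_mix left_diff_distrib)
  qed
  then show ?thesis
    by (simp add: rel_ent_def sum.distrib sum_distrib_left)
qed

lemma tendsto_rel_ent:
  assumes X: "pmf_tendsto X Q" and sub: "\<And>n. set_pmf (X n) \<subseteq> set_pmf P"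
  shows "(\<lambda>n. rel_ent (X n) P) \<longlonglongrightarrow> rel_ent Q P"
  unfolding rel_ent_def
proof (rule tendsto_sum)
  fix x
  have subQ: "set_pmf Q \<subseteq> set_pmf P" by (rule pmf_tendsto_set_subset[OF X sub])
  have *: "pmf R x * ln (pmf R x / pmf P x) = pmf R x * ln (pmf R x) - pmf R x * ln (pmf P x)"
    if "set_pmf R \<subseteq> set_pmf P" for R
  proof (cases "pmf R x = 0")
    case False
    then have "x \<in> set_pmf R" by (simp add: set_pmf_iff)
    with that have "x \<in> set_pmf P" by auto
    then have "pmf P x > 0" "pmf R x > 0"
      using \<open>x \<in> set_pmf R\<close> by (blast intro: pmf_positive)+
    then show ?thesis by (simp add: ln_div right_diff_distrib)
  qed auto
  have lim: "(\<lambda>n. pmf (X n) x) \<longlonglongrightarrow> pmf Q x" using X by (simp add: pmf_tendsto_def)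
  show "(\<lambda>n. pmf (X n) x * ln (pmf (X n) x / pmf P x)) \<longlonglongrightarrow> pmf Q x * ln (pmf Q x / pmf P x)"
    unfolding *[OF sub] *[OF subQ]
    by (intro tendsto_diff tendsto_mult_ln lim tendsto_mult_right) auto
qed

section \<open>Conditional entropy: concavity and continuity\<close>

lemma cond_entropy_eq_sum:
  fixes Q :: "('x::finite \<times> 'y::finite) pmf"
  shows "cond_entropy Q = - (\<Sum>z\<in>UNIV. pmf Q z * ln (pmf Q z / pmf (map_pmf snd Q) (snd z)))"
  by (simp add: cond_entropy_altdef case_prod_unfold)

text \<open>The marginal is linear under mixing and dominates the joint law pointwise, so joint
  convexity applies to every term.\<close>

lemma cond_entropy_mix_ge:
  fixes Q R :: "('x::finite \<times> 'y::finite) pmf"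
  assumes "0 \<le> t" "t \<le> 1"
  shows "(1 - t) * cond_entropy Q + t * cond_entropy R \<le> cond_entropy (mix_pmf t Q R)"
proof -
  let ?m = "\<lambda>Q z. pmf (map_pmf snd Q) (snd z)"
  have zero: "?m Q z = 0 \<Longrightarrow> pmf Q z = 0" for Q :: "('x \<times> 'y) pmf" and z
    using pmf_map_ge[of Q z snd] pmf_nonneg[of Q z] by linarith
  have "(\<Sum>z\<in>UNIV. pmf (mix_pmf t Q R) z * ln (pmf (mix_pmf t Q R) z / ?m (mix_pmf t Q R) z))
      \<le> (\<Sum>z\<in>UNIV. (1 - t) * (pmf Q z * ln (pmf Q z / ?m Q z)) + t * (pmf R z * ln (pmf R z / ?m R z)))"
    unfolding map_mix_pmf pmf_mix[OF assms]
    by (intro sum_mono convex_mult_ln_div assms zero) auto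
  then show ?thesis
    by (simp add: cond_entropy_eq_sum sum.distrib sum_distrib_left)
qed

text \<open>As the difference of joint and marginal entropy, the quantity consists of terms t ln t,
  which are continuous up to 0, whereas the quotient of joint and marginal law may have no limit
  where the marginal vanishes.\<close>

lemma tendsto_cond_entropy:
  fixes Q :: "('x::finite \<times> 'y::finite) pmf"
  assumes X: "pmf_tendsto X Q"
  shows "(\<lambda>n. cond_entropy (X n)) \<longlonglongrightarrow> cond_entropy Q"
proof -
  have *: "cond_entropy R = (\<Sum>y\<in>UNIV. pmf (map_pmf snd R) y * ln (pmf (map_pmf snd R) y))
      - (\<Sum>z\<in>UNIV. pmf R z * ln (pmf R z))" for R :: "('x \<times> 'y) pmf"
  proof -
    have "pmf R z * ln (pmf R z / pmf (map_pmf snd R) (snd z))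
      = pmf R z * ln (pmf R z) - pmf R z * ln (pmf (map_pmf snd R) (snd z))" for z
    proof (cases "pmf R z = 0")
      case False
      then have "pmf R z > 0" by (simp add: less_le)
      then show ?thesis using pmf_map_ge[of R z snd] by (simp add: ln_div right_diff_distrib)
    qed simp
    then show ?thesis
      by (simp add: cond_entropy_eq_sum sum_map_pmf sum_subtractf)
  qed
  show ?thesis
    unfolding *
    using X pmf_tendsto_map[OF X, of snd]
    by (intro tendsto_diff tendsto_sum tendsto_mult_ln) (auto simp: pmf_tendsto_def)
qed

section \<open>Lagrangian duality\<close>

text \<open>The hypothesis \<open>mix\<close> says that f, h, k are convex on C, without asking for a vector space
  structure on the type of C.\<close>

lemma lagrange_multipliers:
  fixes f h k :: "'q \<Rightarrow> real"
  assumes mix: "\<And>q r t. q \<in> C \<Longrightarrow> r \<in> C \<Longrightarrow> 0 \<le> t \<Longrightarrow> t \<le> 1 \<Longrightarrow>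
      \<exists>s\<in>C. f s \<le> (1 - t) * f q + t * f r \<and> h s \<le> (1 - t) * h q + t * h r
        \<and> k s \<le> (1 - t) * k q + t * k r"
    and slater: "q0 \<in> C" "k q0 < 0"
    and opt: "\<And>q. q \<in> C \<Longrightarrow> k q \<le> 0 \<Longrightarrow> p \<le> f q + max 0 (h q)"
  obtains l \<rho> where "0 \<le> l" "l \<le> 1" "0 \<le> \<rho>" "\<And>q. q \<in> C \<Longrightarrow> p \<le> f q + l * h q + \<rho> * k q"
proof -
  \<comment> \<open>\<open>A\<close> is the upward closure of the attained triples, \<open>B\<close>
    the strictly feasible triples that would beat \<open>p\<close>. Giving the argument of the
    positive part its own coordinate lets one separation produce both multipliers.\<close>
  define A where "A = {(a, b, c). \<exists>q\<in>C. f q \<le> a \<and> h q \<le> b \<and> k q \<le> c}"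
  define B where "B = {(a, b, c :: real). a + max 0 b < p \<and> c < 0}"
  have "convex A"
  proof (rule convexI)
    fix u v :: "real \<times> real \<times> real" and s t :: real
    assume uv: "u \<in> A" "v \<in> A" and st: "0 \<le> s" "0 \<le> t" "s + t = 1"
    obtain a b c where u: "u = (a, b, c)" by (cases u)
    obtain a' b' c' where v: "v = (a', b', c')" by (cases v)
    from uv obtain q r where q: "q \<in> C" "f q \<le> a" "h q \<le> b" "k q \<le> c"
      and r: "r \<in> C" "f r \<le> a'" "h r \<le> b'" "k r \<le> c'"
      unfolding A_def u v by auto
    have s: "s = 1 - t" using st by simp
    obtain w where w: "w \<in> C" "f w \<le> s * f q + t * f r" "h w \<le> s * h q + t * h r"
        "k w \<le> s * k q + t * k r"
      using mix[OF q(1) r(1), of t] st unfolding s by auto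
    have "s * f q + t * f r \<le> s * a + t * a'" "s * h q + t * h r \<le> s * b + t * b'"
      "s * k q + t * k r \<le> s * c + t * c'"
      using q r st by (auto intro!: add_mono mult_left_mono)
    with w show "s *\<^sub>R u + t *\<^sub>R v \<in> A"
      unfolding A_def u v by (auto intro!: bexI[of _ w])
  qed
  moreover have "convex B"
  proof (rule convexI)
    fix u v :: "real \<times> real \<times> real" and s t :: real
    assume uv: "u \<in> B" "v \<in> B" and st: "0 \<le> s" "0 \<le> t" "s + t = 1"
    obtain a b c where u: "u = (a, b, c)" by (cases u)
    obtain a' b' c' where v: "v = (a', b', c')" by (cases v)
    have 1: "a + max 0 b < p" "a' + max 0 b' < p" "c < 0" "c' < 0"
      using uv unfolding B_def u v by auto
    have "s * (a + max 0 b) + t * (a' + max 0 b') < p" "s * c + t * c' < 0"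
      using convex_bound_lt[OF 1(1,2) st] convex_bound_lt[OF 1(3,4) st] by auto
    moreover have "max 0 (s * b + t * b') \<le> s * max 0 b + t * max 0 b'"
      using st by (auto intro!: add_mono mult_left_mono add_nonneg_nonneg mult_nonneg_nonneg)
    ultimately show "s *\<^sub>R u + t *\<^sub>R v \<in> B"
      unfolding B_def u v by (auto simp: algebra_simps)
  qed
  moreover have "A \<noteq> {}" using slater unfolding A_def by auto
  moreover have "(p - 1, 0, -1) \<in> B" unfolding B_def by auto
  then have "B \<noteq> {}" by blast
  moreover have "B \<inter> A = {}"
    using opt unfolding A_def B_def by (fastforce simp: max_def split: if_splits)
  ultimately obtain w d where w: "w \<noteq> 0" "\<forall>x\<in>B. inner w x \<le> d" "\<forall>x\<in>A. d \<le> inner w x"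
    using separating_hyperplane_sets[of B A] by blast
  obtain \<alpha> \<beta> \<gamma> where w_eq: "w = (\<alpha>, \<beta>, \<gamma>)" by (cases w)
  have B: "\<alpha> * a + \<beta> * b + \<gamma> * c \<le> d" if "a + max 0 b < p" "c < 0" for a b c
    using w(2) that unfolding B_def w_eq by (auto simp: add.assoc)
  have A: "d \<le> \<alpha> * a + \<beta> * b + \<gamma> * c" if "q \<in> C" "f q \<le> a" "h q \<le> b" "k q \<le> c" for a b c q
    using w(3) that unfolding A_def w_eq by (auto simp: add.assoc)
  have unbounded: "0 \<le> m" if "\<And>n. 0 \<le> n \<Longrightarrow> e \<le> e' + n * m" for m e e' :: real
  proof (rule ccontr)
    assume m: "\<not> 0 \<le> m"
    have "e \<le> e' + (\<bar>e' - e\<bar> + 1) / (- m) * m"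
      using m by (intro that divide_nonneg_pos) auto
    also have "\<dots> = e' - (\<bar>e' - e\<bar> + 1)" using m by (simp add: field_simps)
    finally show False by linarith
  qed
  \<comment> \<open>From the triple of \<open>q0\<close>, \<open>A\<close> contains a ray in each
    positive coordinate direction, and the separating functional is bounded below on it.\<close>
  have nonneg: "0 \<le> \<alpha>" "0 \<le> \<beta>" "0 \<le> \<gamma>"
  proof -
    let ?e = "\<alpha> * f q0 + \<beta> * h q0 + \<gamma> * k q0"
    show "0 \<le> \<alpha>" by (rule unbounded[of d ?e]) (use A[OF slater(1), of "f q0 + _" "h q0" "k q0"] in \<open>auto simp: algebra_simps\<close>)
    show "0 \<le> \<beta>" by (rule unbounded[of d ?e]) (use A[OF slater(1), of "f q0" "h q0 + _" "k q0"] in \<open>auto simp: algebra_simps\<close>)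
    show "0 \<le> \<gamma>" by (rule unbounded[of d ?e]) (use A[OF slater(1), of "f q0" "h q0" "k q0 + _"] in \<open>auto simp: algebra_simps\<close>)
  qed
  \<comment> \<open>The bound passes to the boundary of \<open>B\<close>: the slack \<delta> in the
    first and third coordinates tends to 0, while \<open>b\<close> stays free.\<close>
  have B0: "\<alpha> * (p - max 0 b) + \<beta> * b \<le> d" for b
  proof (rule field_le_epsilon)
    fix e :: real assume "0 < e"
    define \<delta> where "\<delta> = e / (\<alpha> + \<gamma> + 1)"
    have \<delta>: "\<delta> > 0" using \<open>0 < e\<close> nonneg by (simp add: \<delta>_def)
    have "(\<alpha> + \<gamma> + 1) * \<delta> = e"
      using nonneg by (simp add: \<delta>_def)
    then have e: "\<alpha> * \<delta> + \<gamma> * \<delta> \<le> e"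
      using \<delta> by (simp add: distrib_right)
    have "\<alpha> * (p - max 0 b - \<delta>) + \<beta> * b + \<gamma> * (- \<delta>) \<le> d"
      using \<delta> by (intro B) auto
    then show "\<alpha> * (p - max 0 b) + \<beta> * b \<le> d + e"
      using e by (simp add: algebra_simps)
  qed
  \<comment> \<open>For large b the positive part grows at unit rate; this is where l \<le> 1 comes
    from.\<close>
  have "0 \<le> \<alpha> - \<beta>"
  proof (rule unbounded[of "\<alpha> * p" d])
    fix n :: real assume "0 \<le> n"
    then show "\<alpha> * p \<le> d + n * (\<alpha> - \<beta>)" using B0[of n] by (simp add: algebra_simps)
  qed
  \<comment> \<open>Otherwise only \<gamma> > 0 is left and d \<ge> 0, which would force
    \<open>k q0\<close> \<ge> 0 against the Slater point.\<close>
  have "\<alpha> \<noteq> 0"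
  proof
    assume "\<alpha> = 0"
    then have "\<beta> = 0" using \<open>0 \<le> \<alpha> - \<beta>\<close> nonneg by simp
    with \<open>\<alpha> = 0\<close> w(1) nonneg have "\<gamma> > 0" by (auto simp: w_eq zero_prod_def)
    moreover have "0 \<le> \<gamma> * k q0"
      using A[OF slater(1) order_refl order_refl order_refl] B0[of 0] \<open>\<alpha> = 0\<close> \<open>\<beta> = 0\<close> by simp
    ultimately show False using slater(2) by (simp add: zero_le_mult_iff)
  qed
  with nonneg have \<alpha>: "\<alpha> > 0" by simp
  show thesis
  proof (rule that[of "\<beta> / \<alpha>" "\<gamma> / \<alpha>"])
    show "p \<le> f q + \<beta> / \<alpha> * h q + \<gamma> / \<alpha> * k q" if "q \<in> C" for q
    proof -
      have "\<alpha> * p \<le> \<alpha> * f q + \<beta> * h q + \<gamma> * k q"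
        using A[OF that order_refl order_refl order_refl] B0[of 0] by simp
      also have "\<dots> = \<alpha> * (f q + \<beta> / \<alpha> * h q + \<gamma> / \<alpha> * k q)"
        using \<alpha> by (simp add: field_simps)
      finally show ?thesis using \<alpha> by simp
    qed
  qed (use \<alpha> nonneg \<open>0 \<le> \<alpha> - \<beta>\<close> in auto)
qed


section \<open>The Lagrangian of the trade-off problem\<close>

definition FR_excess :: "('x::finite \<times> 'y::finite) pmf \<Rightarrow> ('x \<times> 'y) pmf \<Rightarrow> real" where
  "FR_excess P Q =
     (\<Sum>x\<in>UNIV. pmf (map_pmf fst Q) x * ln (1 / pmf (map_pmf fst P) x)) - cond_entropy Q"

text \<open>\<open>E0\<close> is left out, since it contributes only - (\<rho> + l) * E0, which does
  not depend on \<open>Q\<close>.\<close>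

definition FR_lag ::
    "('x::finite \<times> 'y::finite) pmf \<Rightarrow> real \<Rightarrow> real \<Rightarrow> ('x \<times> 'y) pmf \<Rightarrow> real" where
  "FR_lag P l \<rho> Q =
     rel_ent Q P + l * FR_excess P Q + \<rho> * rel_ent (map_pmf fst Q) (map_pmf fst P)"

text \<open>The marginal divergence is a maximum over W of functions that are linear in Q; this is the
  Lagrangian with one of them in its place.\<close>

definition FR_lag_lin ::
    "('x::finite \<times> 'y::finite) pmf \<Rightarrow> real \<Rightarrow> real \<Rightarrow> 'x pmf \<Rightarrow> ('x \<times> 'y) pmf \<Rightarrow> real" where
  "FR_lag_lin P l \<rho> W Q =
     rel_ent Q P + l * FR_excess P Q
     + \<rho> * (\<Sum>x\<in>UNIV. pmf (map_pmf fst Q) x * ln (pmf W x / pmf (map_pmf fst P) x))"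

lemma sum_pmf_mix_mult:
  fixes Q R :: "'a::finite pmf"
  assumes "0 \<le> t" "t \<le> 1"
  shows "(\<Sum>x\<in>UNIV. pmf (mix_pmf t Q R) x * g x)
    = (1 - t) * (\<Sum>x\<in>UNIV. pmf Q x * g x) + t * (\<Sum>x\<in>UNIV. pmf R x * g x)"
  by (simp add: pmf_mix[OF assms] sum_distrib_left sum.distrib[symmetric] algebra_simps)

lemma FR_excess_mix_le:
  assumes "0 \<le> t" "t \<le> 1"
  shows "FR_excess P (mix_pmf t Q R) \<le> (1 - t) * FR_excess P Q + t * FR_excess P R"
  using cond_entropy_mix_ge[OF assms, of Q R]
  unfolding FR_excess_def map_mix_pmf sum_pmf_mix_mult[OF assms]
  by (simp add: right_diff_distrib)

lemma tendsto_FR_excess: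
  assumes X: "pmf_tendsto X Q"
  shows "(\<lambda>n. FR_excess P (X n)) \<longlonglongrightarrow> FR_excess P Q"
  unfolding FR_excess_def using pmf_tendsto_map[OF X, of fst]
  by (intro tendsto_diff tendsto_cond_entropy X tendsto_sum tendsto_mult_right)
    (auto simp: pmf_tendsto_def)

lemma set_map_pmf_mono: "set_pmf Q \<subseteq> set_pmf P \<Longrightarrow> set_pmf (map_pmf f Q) \<subseteq> set_pmf (map_pmf f P)"
  by auto

text \<open>Inserting W into the logarithm of Q_X / P_X splits off D(Q_X || W). For \<rho> \<ge> 0
  this gap is nonnegative, and it vanishes at W = Q_X.\<close>

lemma FR_lag_eq_lin:
  assumes "set_pmf Q \<subseteq> set_pmf P" "set_pmf (map_pmf fst P) \<subseteq> set_pmf W"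
  shows "FR_lag P l \<rho> Q = FR_lag_lin P l \<rho> W Q + \<rho> * rel_ent (map_pmf fst Q) W"
proof -
  let ?q = "pmf (map_pmf fst Q)" and ?p = "pmf (map_pmf fst P)"
  have "?q x * ln (?q x / ?p x) = ?q x * ln (pmf W x / ?p x) + ?q x * ln (?q x / pmf W x)" for x
  proof (cases "?q x = 0")
    case False
    then have x: "x \<in> set_pmf (map_pmf fst Q)" by (simp only: set_pmf_iff) simp
    then have "x \<in> set_pmf (map_pmf fst P)" using set_map_pmf_mono[OF assms(1), of fst] by blast
    then have "?q x > 0" "?p x > 0" "pmf W x > 0"
      using x assms(2) by (blast intro: pmf_positive)+
    then show ?thesis by (simp add: ln_div algebra_simps)
  qed simp
  then have "rel_ent (map_pmf fst Q) (map_pmf fst P)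
      = (\<Sum>x\<in>UNIV. ?q x * ln (pmf W x / ?p x)) + rel_ent (map_pmf fst Q) W"
    by (simp only: rel_ent_def sum.distrib)
  then show ?thesis by (simp add: FR_lag_def FR_lag_lin_def distrib_left)
qed

lemma FR_lag_lin_mix_le:
  assumes "set_pmf Q \<subseteq> set_pmf P" "set_pmf R \<subseteq> set_pmf P" "0 \<le> t" "t \<le> 1" "0 \<le> l"
  shows "FR_lag_lin P l \<rho> W (mix_pmf t Q R) \<le> (1 - t) * FR_lag_lin P l \<rho> W Q + t * FR_lag_lin P l \<rho> W R"
proof -
  have "l * FR_excess P (mix_pmf t Q R) \<le> l * ((1 - t) * FR_excess P Q + t * FR_excess P R)"
    using assms by (intro mult_left_mono FR_excess_mix_le)
  with rel_ent_mix_le[OF assms(1-4)] show ?thesis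
    unfolding FR_lag_lin_def map_mix_pmf sum_pmf_mix_mult[OF assms(3,4)]
    by (simp add: algebra_simps)
qed

section \<open>The dual function as a minimum of the Lagrangian\<close>

lemma epowr_ennreal_pos: "0 < x \<Longrightarrow> epowr (ennreal x) s = ennreal (x powr s)"
  by (auto simp: epowr_def)

lemma epowr_ennreal_nonneg: "0 \<le> x \<Longrightarrow> 0 < s \<Longrightarrow> epowr (ennreal x) s = ennreal (x powr s)"
  by (auto simp: epowr_def)

lemma sum_UNIV_prod:
  fixes g :: "'x::finite \<times> 'y::finite \<Rightarrow> real"
  shows "(\<Sum>z\<in>UNIV. g z) = (\<Sum>y\<in>UNIV. \<Sum>x\<in>UNIV. g (x, y))"
  by (subst sum.swap) (simp add: sum.cartesian_product)

text \<open>With A = P(x,y) P_X(x)^(\<rho>+l) W(x)^(-\<rho>), the linearized Lagrangian is the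
  Q-mean of (1+l) ln Q_{X|Y} + ln Q_Y - ln A. Minimizing over the conditional law leaves the mean of
  ln Q_Y - (1+l) ln S, and minimizing over the marginal leaves - ln Z. Completing both to
  divergences makes this an identity.\<close>

lemma FR_dual_eq_min:
  fixes P :: "('x::finite \<times> 'y::finite) pmf"
  assumes W: "set_pmf (map_pmf fst P) \<subseteq> set_pmf W" and l: "0 \<le> l"
  obtains R where "set_pmf R \<subseteq> set_pmf P"
    "FR_dual P E0 l \<rho> W = ereal (FR_lag_lin P l \<rho> W R - (\<rho> + l) * E0)"
    "\<And>Q. set_pmf Q \<subseteq> set_pmf P \<Longrightarrow> FR_lag_lin P l \<rho> W R \<le> FR_lag_lin P l \<rho> W Q"
proof -
  define p where "p = pmf (map_pmf fst P)"
  define A where "A z = pmf P z * p (fst z) powr (\<rho> + l) * pmf W (fst z) powr (- \<rho>)" for z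
  define a where "a z = A z powr (1 / (1 + l))" for z
  define S where "S y = (\<Sum>x\<in>UNIV. a (x, y))" for y
  define Z where "Z = (\<Sum>y\<in>UNIV. S y powr (1 + l))"
  have a_nonneg: "0 \<le> a z" for z by (simp add: a_def)
  have S_nonneg: "0 \<le> S y" for y by (simp add: S_def sum_nonneg a_nonneg)
  have pos: "pmf P z > 0" "p (fst z) > 0" "pmf W (fst z) > 0" "A z > 0" "a z > 0" "S (snd z) > 0"
    if z: "z \<in> set_pmf P" for z
  proof -
    show 1: "pmf P z > 0" using z by (rule pmf_positive)
    have "fst z \<in> set_pmf (map_pmf fst P)" using z by simp
    then show 2: "p (fst z) > 0" and 3: "pmf W (fst z) > 0"
      using W unfolding p_def by (blast intro: pmf_positive)+
    show "A z > 0" unfolding A_def using 1 2 3 by simp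
    then show az: "a z > 0" by (simp add: a_def)
    have "a (fst z, snd z) \<le> S (snd z)"
      unfolding S_def by (rule member_le_sum) (auto simp: a_nonneg)
    with az show "S (snd z) > 0" by simp
  qed
  have a_zero: "a z = 0" if "z \<notin> set_pmf P" for z
    using that by (simp add: a_def A_def pmf_eq_0_set_pmf)
  have "Z > 0"
  proof -
    obtain z where z: "z \<in> set_pmf P" using set_pmf_not_empty[of P] by blast
    have "0 < S (snd z) powr (1 + l)" using pos(6)[OF z] by simp
    also have "\<dots> \<le> Z" unfolding Z_def by (rule member_le_sum) auto
    finally show ?thesis .
  qed

  have dual: "FR_dual P E0 l \<rho> W = ereal (- ln Z - (\<rho> + l) * E0)"
  proof -
    have 1: "epowr (ennreal (pmf P (x, y)) * epowr (ennreal (pmf (map_pmf fst P) x)) (\<rho> + l)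
                  * epowr (ennreal (pmf W x)) (- \<rho>)) (1 / (1 + l)) = ennreal (a (x, y))" for x y
    proof (cases "(x, y) \<in> set_pmf P")
      case True
      note pos = pos[OF True]
      have "ennreal (pmf P (x, y)) * epowr (ennreal (pmf (map_pmf fst P) x)) (\<rho> + l)
                  * epowr (ennreal (pmf W x)) (- \<rho>) = ennreal (A (x, y))"
        using pos(1-3) unfolding p_def[symmetric]
        by (simp add: A_def epowr_ennreal_pos ennreal_mult)
      then show ?thesis using pos(4) by (simp add: epowr_ennreal_pos a_def)
    next
      \<comment> \<open>The leading factor 0 absorbs the infinity that arises if W vanishes at
        x.\<close>
      case False
      then show ?thesis using l by (simp add: a_zero pmf_eq_0_set_pmf epowr_def)
    qed
    show ?thesis
      unfolding FR_dual_def 1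
      using l S_nonneg \<open>Z > 0\<close>
      by (simp add: sum_ennreal a_nonneg S_def[symmetric] epowr_ennreal_nonneg Z_def[symmetric] eln_def
          ennreal_eq_0_iff)
  qed

  \<comment> \<open>The minimizer: conditional law a / S of x given y, and marginal in y
    proportional to S^(1+l).\<close>
  define g where "g z = a z * S (snd z) powr l / Z" for z
  have g_nonneg: "0 \<le> g z" for z using \<open>Z > 0\<close> by (simp add: g_def a_nonneg)
  have g_marg: "(\<Sum>x\<in>UNIV. g (x, y)) = S y powr (1 + l) / Z" for y
    using S_nonneg[of y]
    by (simp add: g_def sum_divide_distrib[symmetric] sum_distrib_right[symmetric] S_def[symmetric]
        powr_add)
  have "(\<Sum>z\<in>UNIV. g z) = 1"
    using \<open>Z > 0\<close> by (simp add: sum_UNIV_prod g_marg sum_divide_distrib[symmetric] Z_def[symmetric])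
  with g_nonneg obtain R where R: "\<And>z. pmf R z = g z"
    using exists_pmf_finite[of g] by auto
  have R_marg: "pmf (map_pmf snd R) y = S y powr (1 + l) / Z" for y
    by (simp add: pmf_map_snd R g_marg)
  have set_R: "set_pmf R = set_pmf P"
  proof -
    have "g z \<noteq> 0 \<longleftrightarrow> z \<in> set_pmf P" for z
      using pos[of z] a_zero[of z] \<open>Z > 0\<close> by (cases "z \<in> set_pmf P") (auto simp: g_def)
    then show ?thesis by (auto simp: set_pmf_iff R)
  qed

  \<comment> \<open>The marginal in y is that of \<open>Q\<close>, the conditional law that of the
    minimizer, so the divergence from \<open>b Q\<close> measures only the conditional
    mismatch.\<close>
  define b where "b Q z = pmf (map_pmf snd Q) (snd z) * a z / S (snd z)" for Q :: "('x \<times> 'y) pmf" and z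
  have lag: "FR_lag_lin P l \<rho> W Q
      = l * (\<Sum>z\<in>UNIV. pmf Q z * ln (pmf Q z / b Q z)) + rel_ent Q R - ln Z"
    if Q: "set_pmf Q \<subseteq> set_pmf P" for Q
  proof -
    let ?m = "\<lambda>z. pmf (map_pmf snd Q) (snd z)"
    have "FR_lag_lin P l \<rho> W Q
      = (\<Sum>z\<in>UNIV. pmf Q z * ln (pmf Q z / pmf P z)
         + (l * (pmf Q z * ln (1 / p (fst z)) + pmf Q z * ln (pmf Q z / ?m z))
         + \<rho> * (pmf Q z * ln (pmf W (fst z) / p (fst z)))))"
      by (simp only: FR_lag_lin_def FR_excess_def sum_map_pmf cond_entropy_eq_sum rel_ent_def
          p_def[symmetric] sum.distrib sum_distrib_left[symmetric] diff_minus_eq_add add.assoc)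
    also have "\<dots> = (\<Sum>z\<in>UNIV. l * (pmf Q z * ln (pmf Q z / b Q z))
        + (pmf Q z * ln (pmf Q z / pmf R z) - pmf Q z * ln Z))"
    proof (rule sum.cong)
      fix z
      show "pmf Q z * ln (pmf Q z / pmf P z)
         + (l * (pmf Q z * ln (1 / p (fst z)) + pmf Q z * ln (pmf Q z / ?m z))
         + \<rho> * (pmf Q z * ln (pmf W (fst z) / p (fst z))))
        = l * (pmf Q z * ln (pmf Q z / b Q z)) + (pmf Q z * ln (pmf Q z / pmf R z) - pmf Q z * ln Z)"
      proof (cases "pmf Q z = 0")
        case False
        then have "z \<in> set_pmf Q" by (simp add: set_pmf_iff)
        with Q have z: "z \<in> set_pmf P" by blast
        note pos = pos[OF z]
        have q: "pmf Q z > 0" using False by (simp add: less_le)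
        then have m: "?m z > 0" using pmf_map_ge[of Q z snd] by linarith
        have "(1 + l) * ln (a z) = ln (A z)"
          using l by (simp add: a_def ln_powr)
        also have "\<dots> = ln (pmf P z) + (\<rho> + l) * ln (p (fst z)) - \<rho> * ln (pmf W (fst z))"
          using pos(1-3) by (simp add: A_def ln_mult ln_powr)
        finally have la: "ln (pmf P z)
            = (1 + l) * ln (a z) - (\<rho> + l) * ln (p (fst z)) + \<rho> * ln (pmf W (fst z))"
          by simp
        have lb: "ln (b Q z) = ln (?m z) + ln (a z) - ln (S (snd z))" and "b Q z > 0"
          using pos m by (simp_all add: b_def ln_mult ln_div)
        have lr: "ln (pmf R z) = ln (a z) + l * ln (S (snd z)) - ln Z" and "pmf R z > 0"
          using pos \<open>Z > 0\<close> by (simp_all add: R g_def ln_mult ln_div ln_powr)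
        have "ln (pmf Q z / pmf P z)
         + (l * (ln (1 / p (fst z)) + ln (pmf Q z / ?m z)) + \<rho> * ln (pmf W (fst z) / p (fst z)))
        = l * ln (pmf Q z / b Q z) + (ln (pmf Q z / pmf R z) - ln Z)"
          using pos(1-3) q m \<open>b Q z > 0\<close> \<open>pmf R z > 0\<close>
          by (simp add: ln_div la lb lr algebra_simps)
        from arg_cong[OF this, of "\<lambda>u. pmf Q z * u"] show ?thesis
          by (simp add: algebra_simps)
      qed simp
    qed simp
    also have "\<dots> = l * (\<Sum>z\<in>UNIV. pmf Q z * ln (pmf Q z / b Q z)) + rel_ent Q R - ln Z"
      by (simp add: sum.distrib sum_subtractf sum_distrib_left[symmetric] sum_distrib_right[symmetric]
          rel_ent_def)
    finally show ?thesis .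
  qed

  have lag_ge: "- ln Z \<le> FR_lag_lin P l \<rho> W Q" if Q: "set_pmf Q \<subseteq> set_pmf P" for Q
  proof -
    \<comment> \<open>Division by zero gives 0 where S y = 0, so mass at most 1 is shown; the
      divergence bound asks for no more.\<close>
    have "(\<Sum>z\<in>UNIV. b Q z) = (\<Sum>y\<in>UNIV. pmf (map_pmf snd Q) y * (S y / S y))"
      unfolding sum_UNIV_prod
      by (simp only: b_def snd_conv sum_divide_distrib[symmetric] sum_distrib_left[symmetric]
          S_def[symmetric] times_divide_eq_right)
    also have "\<dots> \<le> (\<Sum>y\<in>UNIV. pmf (map_pmf snd Q) y * 1)"
      by (intro sum_mono mult_left_mono) auto
    finally have "(\<Sum>z\<in>UNIV. b Q z) \<le> 1" by simp
    then have "0 \<le> (\<Sum>z\<in>UNIV. pmf Q z - b Q z)" by (simp add: sum_subtractf)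
    also have "\<dots> \<le> (\<Sum>z\<in>UNIV. pmf Q z * ln (pmf Q z / b Q z))"
    proof (intro sum_mono mult_ln_div_ge)
      fix z
      show "0 \<le> b Q z" by (simp add: b_def a_nonneg S_nonneg)
      show "pmf Q z = 0" if "b Q z = 0"
      proof (rule ccontr)
        assume "pmf Q z \<noteq> 0"
        then have q: "pmf Q z > 0" "z \<in> set_pmf Q" by (simp_all add: set_pmf_iff less_le)
        then have "z \<in> set_pmf P" using Q by blast
        with that show False
          using pos[of z] q(1) pmf_map_ge[of Q z snd] by (auto simp: b_def)
      qed
    qed simp
    finally have "0 \<le> l * (\<Sum>z\<in>UNIV. pmf Q z * ln (pmf Q z / b Q z))"
      using l by simp
    moreover have "0 \<le> rel_ent Q R" using Q by (simp add: rel_ent_nonneg set_R)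
    ultimately show ?thesis using lag[OF Q] by linarith
  qed
  have lag_R: "FR_lag_lin P l \<rho> W R = - ln Z"
  proof -
    have "pmf R z * ln (pmf R z / b R z) = 0" for z
    proof (cases "z \<in> set_pmf P")
      case True
      note pos = pos[OF True]
      have "b R z = pmf R z"
        using pos(6) by (simp add: b_def R_marg R g_def powr_add)
      then show ?thesis by (metis div_self ln_one mult_zero_left mult_zero_right)
    next
      case False
      then have "pmf R z = 0" by (simp add: R g_def a_zero)
      then show ?thesis by simp
    qed
    then have "(\<Sum>z\<in>UNIV. pmf R z * ln (pmf R z / b R z)) = 0" by (simp only: sum.neutral_const)
    then show ?thesis using lag[of R] by (simp add: set_R)
  qed
  show thesis
    by (rule that[of R]) (use dual lag_R lag_ge set_R in auto)
qed

text \<open>A support point missed by W yields an infinite summand, and the positive exponents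
  1/(1+l) and 1+l preserve it. Such W compete in the supremum but cannot raise it.\<close>

lemma FR_dual_MInf:
  fixes P :: "('x::finite \<times> 'y::finite) pmf"
  assumes W: "\<not> set_pmf (map_pmf fst P) \<subseteq> set_pmf W" and "0 \<le> l" "0 < \<rho>"
  shows "FR_dual P E0 l \<rho> W = - \<infinity>"
proof -
  from W obtain z where "z \<in> set_pmf P" "fst z \<notin> set_pmf W" by auto
  then obtain x y where xy: "(x, y) \<in> set_pmf P" "x \<notin> set_pmf W" by (cases z) auto
  let ?t = "\<lambda>x y. epowr (ennreal (pmf P (x, y)) * epowr (ennreal (pmf (map_pmf fst P) x)) (\<rho> + l)
                  * epowr (ennreal (pmf W x)) (- \<rho>)) (1 / (1 + l))"
  have "x \<in> set_pmf (map_pmf fst P)" using xy(1) by force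
  then have p: "pmf (map_pmf fst P) x > 0" "pmf P (x, y) > 0"
    using xy(1) by (blast intro: pmf_positive)+
  have "epowr (ennreal (pmf W x)) (- \<rho>) = \<infinity>"
    using xy(2) \<open>0 < \<rho>\<close> by (simp add: epowr_def pmf_eq_0_set_pmf)
  then have "?t x y = epowr \<infinity> (1 / (1 + l))"
    using p by (simp add: epowr_ennreal_pos ennreal_mult_top ennreal_mult[symmetric] del: ennreal_mult)
  then have "?t x y = \<infinity>" using \<open>0 \<le> l\<close> by (simp add: epowr_def)
  then have 1: "(\<Sum>x\<in>UNIV. ?t x y) = \<infinity>" by (auto simp: ennreal_sum_eq_top)
  have "epowr (\<Sum>x\<in>UNIV. ?t x y) (1 + l) = \<infinity>"
    unfolding 1 using \<open>0 \<le> l\<close> by (simp add: epowr_def)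
  then have "(\<Sum>y\<in>UNIV. epowr (\<Sum>x\<in>UNIV. ?t x y) (1 + l)) = \<infinity>"
    by (auto simp: ennreal_sum_eq_top)
  then show ?thesis unfolding FR_dual_def by (simp only: eln_def) simp
qed

lemma FR_dual_rho_0: "FR_dual P E0 l 0 W = FR_dual P E0 l 0 W'"
  by (simp add: FR_dual_def epowr_def)

section \<open>The best W for fixed multipliers\<close>

text \<open>The divergence is at most the chi-square distance, by ln u \<le> u - 1. The mixture
  differs from \<open>W\<close> by t (U - W), so that distance is quadratic in t.\<close>

lemma rel_ent_mix_self_le:
  fixes W U :: "'a::finite pmf"
  assumes "set_pmf U \<subseteq> set_pmf W" "0 \<le> t" "t \<le> 1"
  shows "rel_ent (mix_pmf t W U) W \<le> t\<^sup>2 * (\<Sum>x\<in>UNIV. (pmf U x - pmf W x)\<^sup>2 / pmf W x)"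
proof -
  have "rel_ent (mix_pmf t W U) W
      \<le> (\<Sum>x\<in>UNIV. t\<^sup>2 * ((pmf U x - pmf W x)\<^sup>2 / pmf W x) + (t * pmf U x - t * pmf W x))"
    unfolding rel_ent_def
  proof (rule sum_mono)
    fix x
    let ?a = "pmf (mix_pmf t W U) x" and ?w = "pmf W x"
    have a: "?a = ?w + t * (pmf U x - ?w)"
      using assms by (simp add: pmf_mix algebra_simps)
    show "?a * ln (?a / ?w) \<le> t\<^sup>2 * ((pmf U x - ?w)\<^sup>2 / ?w) + (t * pmf U x - t * ?w)"
    proof (cases "x \<in> set_pmf W")
      case False
      then have "pmf U x = 0" "?w = 0" using assms(1) by (auto simp: pmf_eq_0_set_pmf)
      then show ?thesis by simp
    next
      case True
      then have w: "?w > 0" by (rule pmf_positive)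
      have "ln (?a / ?w) \<le> ?a / ?w - 1" if "?a > 0"
        using that w by (intro ln_le_minus_one) simp
      then have "?a * ln (?a / ?w) \<le> ?a * (?a / ?w - 1)"
        by (cases "?a = 0") (auto simp: less_le intro!: mult_left_mono)
      also have "\<dots> = (?a - ?w)\<^sup>2 / ?w + (?a - ?w)"
        using w by (simp add: field_simps power2_eq_square)
      also have "\<dots> = t\<^sup>2 * ((pmf U x - ?w)\<^sup>2 / ?w) + (t * pmf U x - t * ?w)"
        unfolding a by (simp add: power_mult_distrib) (simp add: right_diff_distrib)
      finally show ?thesis .
    qed
  qed
  also have "\<dots> = t\<^sup>2 * (\<Sum>x\<in>UNIV. (pmf U x - pmf W x)\<^sup>2 / pmf W x)"
    unfolding sum.distrib sum_subtractf sum_distrib_left[symmetric] by simp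
  finally show ?thesis .
qed

text \<open>Convexity with a gain: at \<open>x0\<close> the mixture has mass t p(x0), whose term is
  exactly t p(x0) ln t. Per unit of t this tends to minus infinity.\<close>

lemma rel_ent_mix_missing_point:
  fixes U p :: "'a::finite pmf"
  assumes "set_pmf U \<subseteq> set_pmf p" "x0 \<notin> set_pmf U" "0 < t" "t \<le> 1"
  shows "rel_ent (mix_pmf t U p) p \<le> (1 - t) * rel_ent U p + t * pmf p x0 * ln t"
proof -
  have U0: "pmf U x0 = 0" using assms by (simp add: pmf_eq_0_set_pmf)
  have "rel_ent (mix_pmf t U p) p
      \<le> (\<Sum>x\<in>UNIV. (1 - t) * (pmf U x * ln (pmf U x / pmf p x)) + t * (pmf p x * ln (pmf p x / pmf p x))
        + (if x = x0 then t * pmf p x0 * ln t else 0))"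
    unfolding rel_ent_def
  proof (rule sum_mono)
    fix x
    have "pmf p x = 0 \<Longrightarrow> pmf U x = 0"
      using assms(1) by (metis pmf_eq_0_set_pmf subsetD)
    then show "pmf (mix_pmf t U p) x * ln (pmf (mix_pmf t U p) x / pmf p x)
      \<le> (1 - t) * (pmf U x * ln (pmf U x / pmf p x)) + t * (pmf p x * ln (pmf p x / pmf p x))
        + (if x = x0 then t * pmf p x0 * ln t else 0)"
      using convex_mult_ln_div[of "pmf U x" "pmf p x" "pmf p x" "pmf p x" t] assms U0
      by (auto simp: pmf_mix left_diff_distrib)
  qed
  also have "\<dots> = (1 - t) * rel_ent U p + t * rel_ent p p + t * pmf p x0 * ln t"
    unfolding rel_ent_def by (simp add: sum.distrib sum_distrib_left)
  finally show ?thesis by simp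
qed

section \<open>Existence and support of the minimizer of the Lagrangian\<close>

lemma FR_lag_attains_min:
  fixes P :: "('x::finite \<times> 'y::finite) pmf"
  obtains Q where "set_pmf Q \<subseteq> set_pmf P"
    "\<And>R. set_pmf R \<subseteq> set_pmf P \<Longrightarrow> FR_lag P l \<rho> Q \<le> FR_lag P l \<rho> R"
proof (rule pmf_attains_min[of "{Q. set_pmf Q \<subseteq> set_pmf P}" "FR_lag P l \<rho>"])
  fix X Q assume X: "\<And>n :: nat. X n \<in> {Q. set_pmf Q \<subseteq> set_pmf P}" "pmf_tendsto X Q"
  then show "Q \<in> {Q. set_pmf Q \<subseteq> set_pmf P}"
    using pmf_tendsto_set_subset[of X Q] by blast
  have sub: "set_pmf (map_pmf fst (X n)) \<subseteq> set_pmf (map_pmf fst P)" for n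
    using X(1) by (intro set_map_pmf_mono) simp
  show "(\<lambda>n. FR_lag P l \<rho> (X n)) \<longlonglongrightarrow> FR_lag P l \<rho> Q"
    unfolding FR_lag_def using X
    by (intro tendsto_add tendsto_mult_left tendsto_rel_ent tendsto_FR_excess pmf_tendsto_map sub) auto
qed (use that in auto)

text \<open>The divergence has slope minus infinity at the boundary of the simplex.\<close>

lemma FR_lag_min_full_support:
  fixes P :: "('x::finite \<times> 'y::finite) pmf"
  assumes "0 \<le> l" "0 < \<rho>" and Q: "set_pmf Q \<subseteq> set_pmf P"
    and min: "\<And>R. set_pmf R \<subseteq> set_pmf P \<Longrightarrow> FR_lag P l \<rho> Q \<le> FR_lag P l \<rho> R"
  shows "set_pmf (map_pmf fst P) \<subseteq> set_pmf (map_pmf fst Q)"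
proof
  fix x0 assume x0: "x0 \<in> set_pmf (map_pmf fst P)"
  show "x0 \<in> set_pmf (map_pmf fst Q)"
  proof (rule ccontr)
    assume nx0: "x0 \<notin> set_pmf (map_pmf fst Q)"
    define c where "c = \<rho> * pmf (map_pmf fst P) x0"
    have c: "c > 0" unfolding c_def using pmf_positive[OF x0] \<open>0 < \<rho>\<close> by simp
    define D where "D = FR_lag P l \<rho> P - FR_lag P l \<rho> Q"
    have D: "0 \<le> D" using min[of P] by (simp add: D_def)
    \<comment> \<open>Chosen so that c ln t = - (D + 1): moving from \<open>Q\<close> towards
      \<open>P\<close> costs at most t D, and the gain at \<open>x0\<close> exceeds it.\<close>
    define t where "t = exp (- ((D + 1) / c))"
    have t: "0 < t" "t \<le> 1" using c D by (simp_all add: t_def)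
    have sub: "set_pmf (mix_pmf t Q P) \<subseteq> set_pmf P"
      using set_mix_pmf_subset[of t Q P] Q by blast
    have e1: "rel_ent (mix_pmf t Q P) P \<le> (1 - t) * rel_ent Q P + t * rel_ent P P"
      using t Q by (intro rel_ent_mix_le) auto
    have e2: "l * FR_excess P (mix_pmf t Q P) \<le> l * ((1 - t) * FR_excess P Q + t * FR_excess P P)"
      using t assms by (intro mult_left_mono FR_excess_mix_le) auto
    have e3: "\<rho> * rel_ent (map_pmf fst (mix_pmf t Q P)) (map_pmf fst P)
        \<le> \<rho> * ((1 - t) * rel_ent (map_pmf fst Q) (map_pmf fst P) + t * pmf (map_pmf fst P) x0 * ln t)"
      unfolding map_mix_pmf using t assms nx0
      by (intro mult_left_mono rel_ent_mix_missing_point set_map_pmf_mono) auto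
    have "FR_lag P l \<rho> (mix_pmf t Q P) \<le> (1 - t) * FR_lag P l \<rho> Q + t * FR_lag P l \<rho> P + t * c * ln t"
      using e1 e2 e3 by (simp add: FR_lag_def c_def algebra_simps)
    then have "0 \<le> t * (D + c * ln t)"
      using min[OF sub] by (simp add: D_def algebra_simps)
    then have "0 \<le> D + c * ln t" using t by (simp add: zero_le_mult_iff)
    moreover have "c * ln t = - (D + 1)" using c by (simp add: t_def)
    ultimately show False by simp
  qed
qed

text \<open>The two Lagrangians differ by a divergence that vanishes to second order at Q, so by convexity
  Q minimizes the second one as well.\<close>

lemma FR_lag_min_lin:
  fixes P :: "('x::finite \<times> 'y::finite) pmf"
  assumes "0 \<le> l" "0 < \<rho>" and Q: "set_pmf Q \<subseteq> set_pmf P"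
    and min: "\<And>R. set_pmf R \<subseteq> set_pmf P \<Longrightarrow> FR_lag P l \<rho> Q \<le> FR_lag P l \<rho> R"
    and R: "set_pmf R \<subseteq> set_pmf P"
  shows "FR_lag P l \<rho> Q \<le> FR_lag_lin P l \<rho> (map_pmf fst Q) R"
proof -
  let ?W = "map_pmf fst Q" and ?U = "map_pmf fst R"
  have full: "set_pmf (map_pmf fst P) \<subseteq> set_pmf ?W"
    by (rule FR_lag_min_full_support[OF assms(1-3) min])
  define c where "c = (\<Sum>x\<in>UNIV. (pmf ?U x - pmf ?W x)\<^sup>2 / pmf ?W x)"
  have c: "0 \<le> c" unfolding c_def by (intro sum_nonneg) auto
  have lagQ: "FR_lag P l \<rho> Q = FR_lag_lin P l \<rho> ?W Q"
    using FR_lag_eq_lin[OF Q full] by simp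
  \<comment> \<open>Along the segment from \<open>Q\<close> to \<open>R\<close>, convexity is linear
    in t and the divergence from the marginal of \<open>Q\<close> is of order t squared; dividing by
    t leaves an error of order t.\<close>
  have step: "FR_lag P l \<rho> Q \<le> FR_lag_lin P l \<rho> ?W R + \<rho> * c * t" if t: "0 < t" "t \<le> 1" for t
  proof -
    let ?M = "mix_pmf t Q R"
    have sub: "set_pmf ?M \<subseteq> set_pmf P"
      using set_mix_pmf_subset[of t Q R] Q R by blast
    have "set_pmf ?U \<subseteq> set_pmf ?W" using set_map_pmf_mono[OF R, of fst] full by blast
    then have "\<rho> * rel_ent (map_pmf fst ?M) ?W \<le> \<rho> * (t\<^sup>2 * c)"
      unfolding map_mix_pmf c_def using t assms(2)
      by (intro mult_left_mono rel_ent_mix_self_le) auto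
    moreover have "FR_lag_lin P l \<rho> ?W ?M
        \<le> (1 - t) * FR_lag_lin P l \<rho> ?W Q + t * FR_lag_lin P l \<rho> ?W R"
      using t assms(1) by (intro FR_lag_lin_mix_le Q R) auto
    moreover note min[OF sub] FR_lag_eq_lin[OF sub full, of l \<rho>]
    ultimately have "t * FR_lag P l \<rho> Q \<le> t * (FR_lag_lin P l \<rho> ?W R + \<rho> * c * t)"
      by (simp add: lagQ[symmetric] algebra_simps power2_eq_square)
    then show ?thesis using t by simp
  qed
  show ?thesis
  proof (rule field_le_epsilon)
    fix e :: real assume "0 < e"
    \<comment> \<open>The summand 1 keeps the denominator positive when c = 0.\<close>
    define t where "t = min 1 (e / (\<rho> * c + 1))"
    have pos: "0 < \<rho> * c + 1" using c assms(2) by (simp add: add_nonneg_pos)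
    then have t: "0 < t" "t \<le> 1" using \<open>0 < e\<close> by (auto simp: t_def)
    have "\<rho> * c * t \<le> (\<rho> * c + 1) * t" using t by (simp add: distrib_right)
    also have "\<dots> \<le> (\<rho> * c + 1) * (e / (\<rho> * c + 1))"
      using pos by (intro mult_left_mono) (auto simp: t_def)
    also have "\<dots> = e" using pos by simp
    finally show "FR_lag P l \<rho> Q \<le> FR_lag_lin P l \<rho> ?W R + e" using step[OF t] by linarith
  qed
qed

text \<open>For every W supporting P_X, the dual value is at most the linearized Lagrangian at
  \<open>Q\<close>, hence at most the true one. Equality at W = Q_X holds because \<open>Q\<close>
  minimizes that linearization too.\<close>

lemma FR_dual_attains_max:
  fixes P :: "('x::finite \<times> 'y::finite) pmf"
  assumes "0 \<le> l" "0 \<le> \<rho>"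
  obtains Q W where "set_pmf Q \<subseteq> set_pmf P"
    "\<And>R. set_pmf R \<subseteq> set_pmf P \<Longrightarrow> FR_lag P l \<rho> Q \<le> FR_lag P l \<rho> R"
    "FR_dual P E0 l \<rho> W = ereal (FR_lag P l \<rho> Q - (\<rho> + l) * E0)"
    "\<And>W'. FR_dual P E0 l \<rho> W' \<le> FR_dual P E0 l \<rho> W"
proof (cases "\<rho> = 0")
  case True
  have lag: "FR_lag P l 0 R = FR_lag_lin P l 0 W' R" for W' R
    by (simp add: FR_lag_def FR_lag_lin_def)
  \<comment> \<open>At \<rho> = 0 every W gives the same value; P_X is taken because it meets the
    support condition.\<close>
  obtain R where R: "set_pmf R \<subseteq> set_pmf P"
    "FR_dual P E0 l \<rho> (map_pmf fst P) = ereal (FR_lag_lin P l \<rho> (map_pmf fst P) R - (\<rho> + l) * E0)"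
    "\<And>Q. set_pmf Q \<subseteq> set_pmf P \<Longrightarrow> FR_lag_lin P l \<rho> (map_pmf fst P) R \<le> FR_lag_lin P l \<rho> (map_pmf fst P) Q"
    using FR_dual_eq_min[of P "map_pmf fst P" l E0 \<rho>] assms(1) by auto
  show ?thesis
    using that[of R "map_pmf fst P"] R FR_dual_rho_0[of P E0 l _ "map_pmf fst P"]
    by (simp add: True lag[of _ "map_pmf fst P"])
next
  case False
  then have \<rho>: "0 < \<rho>" using assms(2) by simp
  obtain Q where Q: "set_pmf Q \<subseteq> set_pmf P"
    and min: "\<And>R. set_pmf R \<subseteq> set_pmf P \<Longrightarrow> FR_lag P l \<rho> Q \<le> FR_lag P l \<rho> R"
    using FR_lag_attains_min[of P l \<rho>] by blast
  let ?W = "map_pmf fst Q"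
  have upper: "FR_dual P E0 l \<rho> W' \<le> ereal (FR_lag P l \<rho> Q - (\<rho> + l) * E0)" for W'
  proof (cases "set_pmf (map_pmf fst P) \<subseteq> set_pmf W'")
    case True
    obtain R where R: "FR_dual P E0 l \<rho> W' = ereal (FR_lag_lin P l \<rho> W' R - (\<rho> + l) * E0)"
      "FR_lag_lin P l \<rho> W' R \<le> FR_lag_lin P l \<rho> W' Q"
      using FR_dual_eq_min[OF True assms(1), of E0 \<rho>] Q by metis
    have "set_pmf (map_pmf fst Q) \<subseteq> set_pmf W'"
      using set_map_pmf_mono[OF Q, of fst] True by blast
    then have "0 \<le> \<rho> * rel_ent (map_pmf fst Q) W'" using \<rho> by (simp add: rel_ent_nonneg)
    then show ?thesis using R FR_lag_eq_lin[OF Q True, of l \<rho>] by simp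
  qed (simp add: FR_dual_MInf assms(1) \<rho>)
  have full: "set_pmf (map_pmf fst P) \<subseteq> set_pmf ?W"
    by (rule FR_lag_min_full_support[OF assms(1) \<rho> Q min])
  obtain R where R: "set_pmf R \<subseteq> set_pmf P"
    "FR_dual P E0 l \<rho> ?W = ereal (FR_lag_lin P l \<rho> ?W R - (\<rho> + l) * E0)"
    using FR_dual_eq_min[OF full assms(1), of E0 \<rho>] by metis
  have "ereal (FR_lag P l \<rho> Q - (\<rho> + l) * E0) \<le> FR_dual P E0 l \<rho> ?W"
    using FR_lag_min_lin[OF assms(1) \<rho> Q min R(1)] R(2) by simp
  with upper have "FR_dual P E0 l \<rho> ?W = ereal (FR_lag P l \<rho> Q - (\<rho> + l) * E0)"
    by (intro antisym)
  with upper show ?thesis using that[OF Q min, of ?W] by simp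
qed

section \<open>The primal problem\<close>

lemma FR_objective_infinite:
  assumes "\<not> set_pmf Q \<subseteq> set_pmf P"
  shows "FR_objective P E0 Q = \<infinity>"
  using assms by (simp add: FR_objective_def kl_altdef)

lemma kl_eq_rel_ent: "kl Q P = (if set_pmf Q \<subseteq> set_pmf P then ereal (rel_ent Q P) else \<infinity>)"
  by (simp add: kl_altdef rel_ent_def)

lemma self_info_eq:
  assumes "set_pmf Q \<subseteq> set_pmf P"
  shows "self_info Q P = ereal (\<Sum>x\<in>UNIV. pmf Q x * ln (1 / pmf P x))"
proof -
  have "ereal (pmf Q x) * eln (1 / ennreal (pmf P x)) = ereal (pmf Q x * ln (1 / pmf P x))" for x
  proof (cases "x \<in> set_pmf Q")
    case True
    then have "pmf P x > 0" using assms by (blast intro: pmf_positive)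
    moreover from this have "1 / ennreal (pmf P x) = ennreal (1 / pmf P x)"
      by (metis divide_ennreal ennreal_1 zero_le_one)
    ultimately show ?thesis by (simp add: eln_def ennreal_eq_0_iff)
  next
    case False
    then have "pmf Q x = 0" by (simp add: pmf_eq_0_set_pmf)
    then show ?thesis by (simp add: zero_ereal_def[symmetric])
  qed
  then show ?thesis by (simp add: self_info_def)
qed

lemma FR_objective_eq:
  assumes "set_pmf Q \<subseteq> set_pmf P"
  shows "FR_objective P E0 Q = ereal (rel_ent Q P + max 0 (FR_excess P Q - E0))"
  unfolding FR_objective_def self_info_eq[OF set_map_pmf_mono[OF assms]]
  using assms by (simp add: kl_eq_rel_ent FR_excess_def zero_ereal_def diff_right_commute flip: ereal_max)

lemma FR_feasible_iff:
  "Q \<in> FR_feasible P E0 \<longleftrightarrow> set_pmf (map_pmf fst Q) \<subseteq> set_pmf (map_pmf fst P)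
    \<and> rel_ent (map_pmf fst Q) (map_pmf fst P) \<le> E0"
  by (simp add: FR_feasible_def kl_eq_rel_ent)

theorem theorem1:
  fixes P :: "('x::finite \<times> 'y::finite) pmf" and E0 :: real
  assumes "E0 > 0"
  shows "(\<exists>Q\<in>FR_feasible P E0. FR_objective P E0 Q = E_FR P E0)
    \<and> E_FR P E0 = (SUP l\<in>{0..1}. SUP \<rho>\<in>{0..}. SUP W. FR_dual P E0 l \<rho> W)
    \<and> (\<exists>l\<in>{0..1}. (SUP \<rho>\<in>{0..}. SUP W. FR_dual P E0 l \<rho> W)
          = (SUP l\<in>{0..1}. SUP \<rho>\<in>{0..}. SUP W. FR_dual P E0 l \<rho> W))
    \<and> (\<forall>l\<in>{0..1}. \<forall>\<rho>\<in>{0..}. \<exists>W. FR_dual P E0 l \<rho> W = (SUP W. FR_dual P E0 l \<rho> W))"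
proof -
  define K where "K Q = rel_ent (map_pmf fst Q) (map_pmf fst P)" for Q :: "('x \<times> 'y) pmf"
  define F where "F Q = rel_ent Q P + max 0 (FR_excess P Q - E0)" for Q
  let ?A = "{Q. set_pmf Q \<subseteq> set_pmf P \<and> K Q \<le> E0}"
  have K_lim: "(\<lambda>n. K (X n)) \<longlonglongrightarrow> K Q"
    if "\<And>n :: nat. set_pmf (X n) \<subseteq> set_pmf P" "pmf_tendsto X Q" for X Q
    unfolding K_def using that by (intro tendsto_rel_ent pmf_tendsto_map set_map_pmf_mono)
  have "P \<in> ?A" using assms by (simp add: K_def)
  then have "?A \<noteq> {}" by blast
  then obtain Q0 where Q0: "Q0 \<in> ?A" "\<And>R. R \<in> ?A \<Longrightarrow> F Q0 \<le> F R"
  proof (rule pmf_attains_min[of ?A F])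
    fix X Q assume X: "\<And>n :: nat. X n \<in> ?A" "pmf_tendsto X Q"
    have "set_pmf Q \<subseteq> set_pmf P" using X pmf_tendsto_set_subset[of X Q] by blast
    moreover have "K Q \<le> E0"
      by (rule LIMSEQ_le_const2[OF K_lim[of X Q]]) (use X in auto)
    ultimately show "Q \<in> ?A" by simp
    show "(\<lambda>n. F (X n)) \<longlonglongrightarrow> F Q"
      unfolding F_def using X
      by (intro tendsto_add tendsto_max tendsto_diff tendsto_const tendsto_rel_ent tendsto_FR_excess) auto
  qed blast
  have feas: "Q0 \<in> FR_feasible P E0"
    using Q0(1) set_map_pmf_mono[of Q0 P fst] by (simp add: FR_feasible_iff K_def)
  have obj: "FR_objective P E0 Q0 = ereal (F Q0)"
    using Q0(1) by (simp add: FR_objective_eq F_def)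
  \<comment> \<open>Feasibility constrains only the marginal in x, so a feasible \<open>Q\<close>
    may leave the support of \<open>P\<close>; its objective is then infinite.\<close>
  have "ereal (F Q0) \<le> FR_objective P E0 Q" if "Q \<in> FR_feasible P E0" for Q
  proof (cases "set_pmf Q \<subseteq> set_pmf P")
    case True
    then have "Q \<in> ?A" using that by (simp add: FR_feasible_iff K_def)
    then show ?thesis using Q0(2) True by (simp add: FR_objective_eq F_def)
  qed (simp add: FR_objective_infinite)
  then have primal: "E_FR P E0 = ereal (F Q0)"
    unfolding E_FR_def using feas obj by (intro antisym INF_greatest) (auto intro: INF_lower2)

  obtain l0 \<rho>0 where l0: "0 \<le> l0" "l0 \<le> 1" "0 \<le> \<rho>0" and lagrange:
    "\<And>Q. Q \<in> {Q. set_pmf Q \<subseteq> set_pmf P} \<Longrightarrow> F Q0 \<le> rel_ent Q P + l0 * (FR_excess P Q - E0) + \<rho>0 * (K Q - E0)"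
  proof (rule lagrange_multipliers[of "{Q. set_pmf Q \<subseteq> set_pmf P}" "\<lambda>Q. rel_ent Q P"
        "\<lambda>Q. FR_excess P Q - E0" "\<lambda>Q. K Q - E0" P "F Q0"])
    fix Q R and t :: real
    assume Q: "Q \<in> {Q. set_pmf Q \<subseteq> set_pmf P}" and R: "R \<in> {Q. set_pmf Q \<subseteq> set_pmf P}"
      and t: "0 \<le> t" "t \<le> 1"
    have "K (mix_pmf t Q R) \<le> (1 - t) * K Q + t * K R"
      unfolding K_def map_mix_pmf using Q R t by (intro rel_ent_mix_le set_map_pmf_mono) auto
    moreover have "rel_ent (mix_pmf t Q R) P \<le> (1 - t) * rel_ent Q P + t * rel_ent R P"
      using Q R t by (intro rel_ent_mix_le) auto
    moreover note FR_excess_mix_le[OF t, of P Q R]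
    moreover have "set_pmf (mix_pmf t Q R) \<subseteq> set_pmf P"
      using Q R set_mix_pmf_subset[of t Q R] by blast
    ultimately show "\<exists>s\<in>{Q. set_pmf Q \<subseteq> set_pmf P}.
        rel_ent s P \<le> (1 - t) * rel_ent Q P + t * rel_ent R P
        \<and> FR_excess P s - E0 \<le> (1 - t) * (FR_excess P Q - E0) + t * (FR_excess P R - E0)
        \<and> K s - E0 \<le> (1 - t) * (K Q - E0) + t * (K R - E0)"
      by (intro bexI[of _ "mix_pmf t Q R"]) (auto simp: algebra_simps)
  next
    show "K P - E0 < 0" using assms by (simp add: K_def)
  next
    show "F Q0 \<le> rel_ent Q P + max 0 (FR_excess P Q - E0)"
      if "Q \<in> {Q. set_pmf Q \<subseteq> set_pmf P}" "K Q - E0 \<le> 0" for Q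
      using Q0(2)[of Q] that by (simp add: F_def)
  qed (use that in auto)

  let ?D = "\<lambda>l. SUP \<rho>\<in>{0..}. SUP W. FR_dual P E0 l \<rho> W"
  \<comment> \<open>Weak duality: the minimum of the Lagrangian is compared with its value at
    \<open>Q0\<close>, where l \<le> 1 bounds the second term by the positive part and feasibility
    makes the third nonpositive.\<close>
  have upper: "FR_dual P E0 l \<rho> W \<le> ereal (F Q0)" if "l \<in> {0..1}" "\<rho> \<in> {0..}" for l \<rho> W
  proof -
    obtain Q W' where Q:
      "\<And>R. set_pmf R \<subseteq> set_pmf P \<Longrightarrow> FR_lag P l \<rho> Q \<le> FR_lag P l \<rho> R"
      "FR_dual P E0 l \<rho> W' = ereal (FR_lag P l \<rho> Q - (\<rho> + l) * E0)"
      "FR_dual P E0 l \<rho> W \<le> FR_dual P E0 l \<rho> W'"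
      using FR_dual_attains_max[of l \<rho> P E0] \<open>l \<in> {0..1}\<close> \<open>\<rho> \<in> {0..}\<close> by (metis atLeastAtMost_iff atLeast_iff)
    have "FR_lag P l \<rho> Q - (\<rho> + l) * E0 \<le> FR_lag P l \<rho> Q0 - (\<rho> + l) * E0"
      using Q(1) Q0(1) by simp
    also have "\<dots> = rel_ent Q0 P + l * (FR_excess P Q0 - E0) + \<rho> * (K Q0 - E0)"
      by (simp add: FR_lag_def K_def algebra_simps)
    also have "\<dots> \<le> F Q0"
    proof -
      have "l * (FR_excess P Q0 - E0) \<le> l * max 0 (FR_excess P Q0 - E0)"
        using that by (intro mult_left_mono) auto
      also have "\<dots> \<le> 1 * max 0 (FR_excess P Q0 - E0)"
        using that by (intro mult_right_mono) auto
      finally have "l * (FR_excess P Q0 - E0) \<le> max 0 (FR_excess P Q0 - E0)" by simp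
      moreover have "\<rho> * (K Q0 - E0) \<le> 0"
        using that Q0(1) by (intro mult_nonneg_nonpos) auto
      ultimately show ?thesis by (simp add: F_def)
    qed
    finally have "FR_dual P E0 l \<rho> W' \<le> ereal (F Q0)" using Q(2) by simp
    with Q(3) show ?thesis by (rule order_trans)
  qed
  then have D_le: "?D l \<le> ereal (F Q0)" if "l \<in> {0..1}" for l
    using that by (intro SUP_least) auto
  have "ereal (F Q0) \<le> ?D l0"
  proof -
    obtain Q W where Q: "set_pmf Q \<subseteq> set_pmf P"
      "FR_dual P E0 l0 \<rho>0 W = ereal (FR_lag P l0 \<rho>0 Q - (\<rho>0 + l0) * E0)"
      using FR_dual_attains_max[of l0 \<rho>0 P E0] l0 by metis
    have "F Q0 \<le> FR_lag P l0 \<rho>0 Q - (\<rho>0 + l0) * E0"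
      using lagrange[of Q] Q(1) by (simp add: FR_lag_def K_def algebra_simps)
    then have "ereal (F Q0) \<le> FR_dual P E0 l0 \<rho>0 W" using Q(2) by simp
    also have "\<dots> \<le> ?D l0"
      using l0 by (intro SUP_upper2[of \<rho>0] SUP_upper) auto
    finally show ?thesis .
  qed
  \<comment> \<open>The single multiplier \<open>l0\<close> already reaches the primal value, so the
    supremum over l is a maximum.\<close>
  with D_le have D_l0: "?D l0 = ereal (F Q0)" using l0 by (intro antisym) auto
  have D: "(SUP l\<in>{0..1}. ?D l) = ereal (F Q0)"
  proof (rule antisym)
    show "(SUP l\<in>{0..1}. ?D l) \<le> ereal (F Q0)" by (rule SUP_least) (rule D_le)
    show "ereal (F Q0) \<le> (SUP l\<in>{0..1}. ?D l)"
      using SUP_upper[of l0 "{0..1}" ?D] l0 D_l0 by simp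
  qed
  have attained: "\<exists>W. FR_dual P E0 l \<rho> W = (SUP W. FR_dual P E0 l \<rho> W)"
    if "l \<in> {0..1}" "\<rho> \<in> {0..}" for l \<rho>
  proof -
    have "0 \<le> l" "0 \<le> \<rho>" using that by auto
    then obtain W where "\<forall>W'. FR_dual P E0 l \<rho> W' \<le> FR_dual P E0 l \<rho> W"
      by (rule FR_dual_attains_max[of l \<rho> P E0]) blast
    then show ?thesis by (intro exI[of _ W] antisym SUP_least SUP_upper) auto
  qed
  show ?thesis
    using feas obj primal D D_l0 l0 attained by (metis (no_types, lifting) atLeastAtMost_iff)
qed

end
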